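(* Let $X$ be a non-empty set and let $\mathscr{P}_X$ be a transformation poloid on $X$. Then $\mathscr{P}_X$, with the partial operation $\circ$, is a poloid.
   Context: A (partial) magma is a non-empty set $P$ with a partial binary operation $(x,y)\mapsto xy$, i.e. a function from some non-empty subset of $P\times P$ to $P$; "$xy$ is defined" means that $(x,y)$ lies in that subset. A compound expression is defined when all its successive products are: $(xy)z$ is defined iff $xy$ is defined and the product of $xy$ with $z$ is defined; similarly for $x(yz)$. A semigroupoid is a magma $P$ such that for all $x,y,z\in P$: if (a) $xy$ and $yz$ are both defined, or (b) $x(yz)$ is defined, or (c) $(xy)z$ is defined, then $(xy)z$ and $x(yz)$ are both defined and $(xy)z=x(yz)$. A unit in a magma $P$ is an $e\in P$ such that $ex=x$ for all $x$ for which $ex$ is defined and $xe=x$ for all $x$ for which $xe$ is defined. A poloid is a semigroupoid $P$ such that for every $x\in P$ there are units $\epsilon_x,\varepsilon_x\in P$ such that $\epsilon_x x$ and $x\varepsilon_x$ are defined. A transformation $f$ on $X$ consists of a subset $\mathrm{dom}(f)\subseteq X$, a rule assigning to each $x\in\mathrm{dom}(f)$ exactly one $f(x)\in X$, and a subset $\mathrm{cod}(f)\subseteq X$ with $\mathrm{im}(f)=\{f(x)\mid x\in\mathrm{dom}(f)\}\subseteq\mathrm{cod}(f)$. Two transformations are equal iff they have the same domain, codomain and values. It is non-empty if $\mathrm{dom}(f)\neq\emptyset$. For $S\subseteq X$, $Id_S$ is the transformation with $\mathrm{dom}(Id_S)=\mathrm{cod}(Id_S)=S$ and $Id_S(x)=x$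 for $x\in S$. A transformation magma on $X$ is a set $\mathscr{F}_X$ of non-empty transformations on $X$ that is a magma under the partial operation $\circ$, where $f\circ g$ is defined iff $\mathrm{dom}(f)\supseteq\mathrm{im}(g)$, and then $\mathrm{dom}(f\circ g)=\mathrm{dom}(g)$, $\mathrm{cod}(f\circ g)=\mathrm{cod}(f)$, $(f\circ g)(x)=f(g(x))$ for $x\in\mathrm{dom}(g)$ (in particular, $f\circ g\in\mathscr{F}_X$ whenever $f,g\in\mathscr{F}_X$ and $f\circ g$ is defined). A transformation semigroupoid on $X$ is a transformation magma $\mathscr{F}_X$ on $X$ such that for all $f,g\in\mathscr{F}_X$, if $\mathrm{dom}(f)\supseteq\mathrm{im}(g)$ then $\mathrm{dom}(f)=\mathrm{cod}(g)$. A transformation poloid on $X$ is a transformation semigroupoid $\mathscr{S}_X$ on $X$ such that if $f\in\mathscr{S}_X$ then $Id_{\mathrm{dom}(f)},Id_{\mathrm{cod}(f)}\in\mathscr{S}_X$. *)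

theory Defs
  imports Main
begin

text \<open>
  A partial operation is a function into the option type; \<open>m x y = None\<close> means that the product
  of \<open>x\<close> and \<open>y\<close> is undefined. Products are defined only for elements of the carrier, so the
  domain of the operation is a subset of \<open>P \<times> P\<close>.
\<close>

locale partial_magma =
  fixes P :: "'a set" and m :: "'a \<Rightarrow> 'a \<Rightarrow> 'a option"
  assumes carrier_nonempty: "P \<noteq> {}"
    and domain_nonempty: "\<exists>x y. m x y \<noteq> None"
    and domain_subset: "m x y \<noteq> None \<Longrightarrow> x \<in> P \<and> y \<in> P"
    and closed: "m x y = Some z \<Longrightarrow> z \<in> P"
begin

definition is_unit :: "'a \<Rightarrow> bool" where
  "is_unit e \<longleftrightarrow> e \<in> P \<and>
     (\<forall>x\<in>P. m e x \<noteq> None \<longrightarrow> m e x = Some x) \<and>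
     (\<forall>x\<in>P. m x e \<noteq> None \<longrightarrow> m x e = Some x)"

definition prod_left :: "'a \<Rightarrow> 'a \<Rightarrow> 'a \<Rightarrow> 'a option" where
  "prod_left x y z = Option.bind (m x y) (\<lambda>u. m u z)"

definition prod_right :: "'a \<Rightarrow> 'a \<Rightarrow> 'a \<Rightarrow> 'a option" where
  "prod_right x y z = Option.bind (m y z) (\<lambda>u. m x u)"

end

locale semigroupoid = partial_magma +
  assumes assoc:
    "\<lbrakk>x \<in> P; y \<in> P; z \<in> P;
      (m x y \<noteq> None \<and> m y z \<noteq> None) \<or> prod_right x y z \<noteq> None \<or> prod_left x y z \<noteq> None\<rbrakk>
     \<Longrightarrow> prod_left x y z \<noteq> None \<and> prod_right x y z \<noteq> None \<and> prod_left x y z = prod_right x y z"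

locale poloid = semigroupoid +
  assumes units:
    "x \<in> P \<Longrightarrow> \<exists>e e'. is_unit e \<and> is_unit e' \<and> m e x \<noteq> None \<and> m x e' \<noteq> None"

text \<open>
  A transformation is a partial map together with a codomain. Since the map carries its own domain,
  equality of transformations is equality of domains, codomains and values.
\<close>

datatype 'a transf = Transf (tmap: "'a \<rightharpoonup> 'a") (tcod: "'a set")

definition tdom :: "'a transf \<Rightarrow> 'a set" where
  "tdom f = dom (tmap f)"

definition tim :: "'a transf \<Rightarrow> 'a set" where
  "tim f = ran (tmap f)"

definition transformation_on :: "'a set \<Rightarrow> 'a transf \<Rightarrow> bool" where
  "transformation_on X f \<longleftrightarrow> tdom f \<subseteq> X \<and> tim f \<subseteq> tcod f \<and> tcod f \<subseteq> X"

definition tid :: "'a set \<Rightarrow> 'a transf" where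
  "tid S = Transf (Some |` S) S"

definition tcomp :: "'a transf \<Rightarrow> 'a transf \<Rightarrow> 'a transf option" where
  "tcomp f g = (if tim g \<subseteq> tdom f then Some (Transf (tmap f \<circ>\<^sub>m tmap g) (tcod f)) else None)"

lemma tcomp_SomeD:
  assumes "tcomp f g = Some h"
  shows "tdom h = tdom g" and "tcod h = tcod f"
    and "x \<in> tdom g \<Longrightarrow> the (tmap h x) = the (tmap f (the (tmap g x)))"
  using assms
  by (fastforce simp: tcomp_def tdom_def tim_def map_comp_def ran_def split: if_splits option.splits)+

definition tcomp_on :: "'a transf set \<Rightarrow> 'a transf \<Rightarrow> 'a transf \<Rightarrow> 'a transf option" where
  "tcomp_on F f g = (if f \<in> F \<and> g \<in> F then tcomp f g else None)"

text \<open>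
  Closure of \<open>F\<close> under composition is part of \<open>partial_magma F (tcomp_on F)\<close>, as \<open>tcomp_on\<close>
  restricts the arguments, but not the result, to \<open>F\<close>.
\<close>

locale transformation_magma =
  fixes X :: "'a set" and F :: "'a transf set"
  assumes transformations: "f \<in> F \<Longrightarrow> transformation_on X f"
    and nonempty_transformations: "f \<in> F \<Longrightarrow> tdom f \<noteq> {}"
    and magma: "partial_magma F (tcomp_on F)"

locale transformation_semigroupoid = transformation_magma +
  assumes dom_eq_cod: "\<lbrakk>f \<in> F; g \<in> F; tim g \<subseteq> tdom f\<rbrakk> \<Longrightarrow> tdom f = tcod g"

locale transformation_poloid = transformation_semigroupoid +
  assumes tid_dom: "f \<in> F \<Longrightarrow> tid (tdom f) \<in> F"
    and tid_cod: "f \<in> F \<Longrightarrow> tid (tcod f) \<in> F"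

end

theory Submission
  imports Defs
begin

text \<open>
  If \<open>f(gh)\<close> is defined, then \<open>im(gh) \<subseteq> dom(f)\<close> alone does not give \<open>im(g) \<subseteq> dom(f)\<close>; the
  semigroupoid condition does, since \<open>dom(f) = cod(gh) = cod(g)\<close>. The same condition forces
  \<open>dom(f) = cod(g)\<close> for every defined product, which makes the identities in the poloid units:
  \<open>Id\<^sub>S \<circ> g\<close> has codomain \<open>S = cod(g)\<close>, and \<open>g \<circ> Id\<^sub>S\<close> has domain \<open>S = dom(g)\<close>.
\<close>

lemma tdom_tid [simp]: "tdom (tid S) = S"
  by (auto simp: tdom_def tid_def restrict_map_def split: if_splits)

lemma tim_tid [simp]: "tim (tid S) = S"
  by (auto simp: tim_def tid_def ran_def restrict_map_def)

lemma tcod_tid [simp]: "tcod (tid S) = S"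
  by (simp add: tid_def)

lemma tim_tcomp: "tcomp f g = Some h \<Longrightarrow> tim h \<subseteq> tim f"
  by (auto simp: tcomp_def tim_def ran_def map_comp_def split: if_splits option.splits)

lemma tcomp_eq_None_iff: "tcomp f g = None \<longleftrightarrow> \<not> tim g \<subseteq> tdom f"
  by (simp add: tcomp_def)

text \<open>Both outer products are defined because a composite keeps the domain of its right factor
  and its image lies in that of its left factor: im(h) lies in dom(g) = dom(u), and im(v) in im(g),
  hence in dom(f).\<close>

lemma tcomp_assoc:
  assumes "tcomp f g = Some u" and "tcomp g h = Some v"
  shows "\<exists>w. tcomp u h = Some w \<and> tcomp f v = Some w"
proof -
  have "tim h \<subseteq> tdom u"
    using assms tcomp_SomeD(1)[OF assms(1)] by (auto simp: tcomp_def split: if_splits)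
  moreover have "tim v \<subseteq> tdom f"
    using assms(1) tim_tcomp[OF assms(2)] by (auto simp: tcomp_def split: if_splits)
  moreover have "tmap u \<circ>\<^sub>m tmap h = tmap f \<circ>\<^sub>m tmap v"
    using assms by (auto simp: tcomp_def map_comp_def fun_eq_iff split: if_splits option.splits)
  ultimately show ?thesis
    using tcomp_SomeD(2)[OF assms(1)] by (simp add: tcomp_def)
qed

text \<open>A composite takes its codomain from the left factor, so the identity must be the one on
  cod(g), not on im(g).\<close>

lemma tcomp_tid_left:
  assumes "tim g \<subseteq> tcod g"
  shows "tcomp (tid (tcod g)) g = Some g"
proof -
  have "(Some |` tcod g) \<circ>\<^sub>m tmap g = tmap g"
    using assms
    by (auto simp: tim_def ran_def map_comp_def restrict_map_def fun_eq_iff split: option.splits)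
  with assms show ?thesis
    by (cases g) (simp add: tcomp_def, simp add: tid_def)
qed

lemma tcomp_tid_right: "tcomp f (tid (tdom f)) = Some f"
proof -
  have "tmap f \<circ>\<^sub>m (Some |` tdom f) = tmap f"
    by (auto simp: tdom_def map_comp_def restrict_map_def fun_eq_iff dom_def split: option.splits)
  then show ?thesis
    by (cases f) (simp add: tcomp_def, simp add: tid_def)
qed

context transformation_magma
begin

lemma tim_subset_tcod: "f \<in> F \<Longrightarrow> tim f \<subseteq> tcod f"
  using transformations by (auto simp: transformation_on_def)

lemma tcomp_closed: "\<lbrakk>f \<in> F; g \<in> F; tcomp f g = Some h\<rbrakk> \<Longrightarrow> h \<in> F"
  using partial_magma.closed[OF magma, of f g h] by (simp add: tcomp_on_def)

end

context transformation_semigroupoid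
begin

lemma semigroupoid_tcomp_on: "semigroupoid F (tcomp_on F)"
proof -
  interpret partial_magma F "tcomp_on F" by (rule magma)
  show ?thesis
  proof
    fix f g h
    assume F: "f \<in> F" "g \<in> F" "h \<in> F"
      and defined: "(tcomp_on F f g \<noteq> None \<and> tcomp_on F g h \<noteq> None) \<or>
        prod_right f g h \<noteq> None \<or> prod_left f g h \<noteq> None"
    \<comment> \<open>All three alternatives are reduced to the first, from which
      \<open>tcomp_assoc\<close> yields the conclusion.\<close>
    have "tcomp f g \<noteq> None \<and> tcomp g h \<noteq> None"
      using defined
    proof (elim disjE)
      assume "tcomp_on F f g \<noteq> None \<and> tcomp_on F g h \<noteq> None"
      then show ?thesis using F by (simp add: tcomp_on_def)
    next
      assume "prod_right f g h \<noteq> None"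
      then obtain v where v: "tcomp g h = Some v" "v \<in> F" "tcomp f v \<noteq> None"
        using F by (auto simp: prod_right_def tcomp_on_def split: bind_splits if_splits)
      then have "tim v \<subseteq> tdom f"
        by (simp add: tcomp_eq_None_iff)
      then have "tdom f = tcod g"
        using dom_eq_cod[OF F(1) v(2)] tcomp_SomeD(2)[OF v(1)] by metis
      then show ?thesis
        using v(1) tim_subset_tcod[OF F(2)] by (simp add: tcomp_eq_None_iff)
    next
      assume "prod_left f g h \<noteq> None"
      then obtain u where u: "tcomp f g = Some u" "tcomp u h \<noteq> None"
        using F by (auto simp: prod_left_def tcomp_on_def split: bind_splits if_splits)
      \<comment> \<open>As dom(fg) = dom(g), the product (fg)h is defined exactly when gh
        is.\<close>
      then show ?thesis
        using tcomp_SomeD(1)[OF u(1)] by (simp add: tcomp_eq_None_iff)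
    qed
    then obtain u v where uv: "tcomp f g = Some u" "tcomp g h = Some v" by auto
    \<comment> \<open>\<open>tcomp_on\<close> also tests membership of the factors, here of the
      inner products.\<close>
    moreover have "u \<in> F" "v \<in> F"
      using uv F tcomp_closed by blast+
    ultimately show "prod_left f g h \<noteq> None \<and> prod_right f g h \<noteq> None \<and>
        prod_left f g h = prod_right f g h"
      using F tcomp_assoc[OF uv] by (auto simp: prod_left_def prod_right_def tcomp_on_def)
  qed
qed

lemma is_unit_tid:
  assumes "tid S \<in> F"
  shows "partial_magma.is_unit F (tcomp_on F) (tid S)"
proof -
  have "tcomp (tid S) g = Some g" if g: "g \<in> F" and "tcomp (tid S) g \<noteq> None" for g
  proof -
    have "tim g \<subseteq> tdom (tid S)"
      using that by (simp add: tcomp_eq_None_iff)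
    \<comment> \<open>With another S the product would have the values of g but a different
      codomain, so it would not equal g.\<close>
    then have "S = tcod g"
      using dom_eq_cod[OF assms g] by (metis tdom_tid)
    then show ?thesis
      using tcomp_tid_left[OF tim_subset_tcod[OF g]] by metis
  qed
  moreover have "tcomp g (tid S) = Some g" if g: "g \<in> F" and "tcomp g (tid S) \<noteq> None" for g
  proof -
    have "tim (tid S) \<subseteq> tdom g"
      using that by (simp add: tcomp_eq_None_iff)
    \<comment> \<open>The inclusion of S in dom(g) alone would allow a proper restriction of g; the
      semigroupoid condition, with cod(Id) = S, excludes it.\<close>
    then have "tdom g = S"
      using dom_eq_cod[OF g assms] by (metis tcod_tid)
    then show ?thesis
      using tcomp_tid_right by metis
  qed
  ultimately show ?thesis
    using assms unfolding partial_magma.is_unit_def[OF magma] tcomp_on_def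
    by (intro conjI ballI impI) (metis+)
qed

end

theorem theorem2:
  fixes X :: "'a set" and F :: "'a transf set"
  assumes "X \<noteq> {}"
    and "transformation_poloid X F"
  shows "poloid F (tcomp_on F)"
proof -
  interpret transformation_poloid X F by (rule assms(2))
  interpret semigroupoid F "tcomp_on F" by (rule semigroupoid_tcomp_on)
  show ?thesis
  proof
    fix f assume f: "f \<in> F"
    \<comment> \<open>The left unit is the identity on cod(f), the right unit the one on
      dom(f).\<close>
    have "tcomp_on F (tid (tcod f)) f \<noteq> None" "tcomp_on F f (tid (tdom f)) \<noteq> None"
      using f tid_cod tid_dom tcomp_tid_left[OF tim_subset_tcod[OF f]] tcomp_tid_right[of f]
      by (auto simp: tcomp_on_def)
    then show "\<exists>e e'. is_unit e \<and> is_unit e' \<and> tcomp_on F e f \<noteq> None \<and> tcomp_on F f e' \<noteq> None"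
      using is_unit_tid tid_cod[OF f] tid_dom[OF f] by blast
  qed
qed

end
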